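(* Let $\omega\in(0,1)$, $\beta>0$, $b\in\mathbb R$, $t\ge0$, and let $T':[b,\infty)\to[0,\infty)$ be a function. Define $$F'_{\beta,t}(x)=\frac{1-(1-\omega)\,t\,e^{-\beta x}}{\omega},\qquad x\ge b .$$ The following are equivalent: (i) for every random variable $X$ with a discrete distribution on $[b,\infty)$, $\ (1-\omega)\,t\,e^{-\beta\,\mathbb E(X)}+\omega\,\mathbb E(T'(X))\le1$; (ii) for every random variable $X$ with a discrete distribution on $[b,\infty)$, $\ (1-\omega)\,t\,\mathbb E(e^{-\beta X})+\omega\,\mathbb E(T'(X))\le1$; (iii) $T'(x)\le F'_{\beta,t}(x)$ for all $x\ge b$. Moreover, if these conditions hold then $t\in[0,e^{\beta b}/(1-\omega)]$; and conversely, for every $t\in[0,e^{\beta b}/(1-\omega)]$ the function $T'=F'_{\beta,t}$ is non-negative on $[b,\infty)$ and satisfies (i) and (ii).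
   Context: A discrete distribution is one giving probability $1$ to a countable set. If $\mathbb E(X)=+\infty$, then $e^{-\beta\mathbb E(X)}=0$. (Inequalities (i) and (ii) are the single-trial conditions for the non-negative function $T(X,Y)$ equal to $T'(X)$ if $Y=0$ and to $t$ if $Y=1$, where $Y\in\{0,1\}$ is independent of $X$ with $\mathbb P(Y=0)=\omega$, to satisfy $\mathbb E(T(X,Y)e^{-\beta Y\mathbb E(X)})\le 1$, respectively $\mathbb E(T(X,Y)e^{-\beta YX})\le1$.) *)

theory Defs
  imports "HOL-Probability.Probability"
begin

definition discrete_rv_on :: "real set \<Rightarrow> 'a measure \<Rightarrow> ('a \<Rightarrow> real) \<Rightarrow> bool" where
  "discrete_rv_on S M X \<longleftrightarrow>
     prob_space M \<and> X \<in> borel_measurable M \<and>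
     (\<exists>C. countable C \<and> C \<subseteq> S \<and> measure (distr M borel X) C = 1)"

(* Expectation of X as an extended real, positive part minus negative part (the coercion ennreal
   sends negative reals to 0).  For X bounded below the negative part has finite expectation, so
   no indeterminate difference arises. *)
definition ext_expectation :: "'a measure \<Rightarrow> ('a \<Rightarrow> real) \<Rightarrow> ereal" where
  "ext_expectation M X =
     enn2ereal (\<integral>\<^sup>+ w. ennreal (X w) \<partial>M) - enn2ereal (\<integral>\<^sup>+ w. ennreal (- X w) \<partial>M)"

(* exp (- \<beta> m), extended by 0 at m = \<infinity>; only used for m > -\<infinity>. *)
definition exp_neg :: "real \<Rightarrow> ereal \<Rightarrow> real" where
  "exp_neg \<beta> m = (if m = \<infinity> then 0 else exp (- \<beta> * real_of_ereal m))"

(* The expectation of T'(X) may be infinite, so both inequalities live in ennreal.  T' is an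
   arbitrary function: the composition of T' and X agrees almost everywhere with a measurable
   function when X is discrete, and nn_integral, a supremum over simple functions below the
   integrand, then has the value of the integral of that function. *)
definition cond_expected :: "real \<Rightarrow> real \<Rightarrow> real \<Rightarrow> (real \<Rightarrow> real) \<Rightarrow> 'a measure \<Rightarrow> ('a \<Rightarrow> real) \<Rightarrow> bool" where
  "cond_expected \<omega> \<beta> t T' M X \<longleftrightarrow>
     ennreal ((1 - \<omega>) * t * exp_neg \<beta> (ext_expectation M X))
       + ennreal \<omega> * (\<integral>\<^sup>+ w. ennreal (T' (X w)) \<partial>M) \<le> 1"

definition cond_realized :: "real \<Rightarrow> real \<Rightarrow> real \<Rightarrow> (real \<Rightarrow> real) \<Rightarrow> 'a measure \<Rightarrow> ('a \<Rightarrow> real) \<Rightarrow> bool" where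
  "cond_realized \<omega> \<beta> t T' M X \<longleftrightarrow>
     ennreal ((1 - \<omega>) * t) * (\<integral>\<^sup>+ w. ennreal (exp (- \<beta> * X w)) \<partial>M)
       + ennreal \<omega> * (\<integral>\<^sup>+ w. ennreal (T' (X w)) \<partial>M) \<le> 1"

definition F' :: "real \<Rightarrow> real \<Rightarrow> real \<Rightarrow> real \<Rightarrow> real" where
  "F' \<omega> \<beta> t x = (1 - (1 - \<omega>) * t * exp (- \<beta> * x)) / \<omega>"

end

theory Submission
  imports Defs
begin

text \<open>
  By Jensen's inequality the realized condition implies the expected one; where \<open>T'\<close> is
  dominated by \<open>F'\<close>, the realized condition is an integrated pointwise identity.  Conversely, on
  constant random variables both conditions are the pointwise bound.
\<close>

text \<open>Countable sets are Borel, so full mass of the distribution on \<open>C\<close> pulls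
  back along \<open>X\<close> to an almost-everywhere statement on \<open>M\<close>.\<close>

lemma discrete_rv_on_AE:
  assumes "discrete_rv_on S M X"
  shows "AE w in M. X w \<in> S"
proof -
  from assms have M: "prob_space M" and [measurable]: "X \<in> borel_measurable M"
    by (auto simp: discrete_rv_on_def)
  from assms obtain C where C: "countable C" "C \<subseteq> S" "measure (distr M borel X) C = 1"
    by (auto simp: discrete_rv_on_def)
  interpret D: prob_space "distr M borel X"
    by (rule prob_space.prob_space_distr[OF M]) simp
  have "C \<in> sets borel"
    by (rule sets.countable[OF _ C(1)]) simp
  with C(3) have "AE x in distr M borel X. x \<in> C"
    by (subst (asm) D.prob_eq_1) auto
  with \<open>C \<in> sets borel\<close> have "AE w in M. X w \<in> C"
    by (subst (asm) AE_distr_iff) auto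
  then show ?thesis
    using C(2) by auto
qed

text \<open>The point mass at \<open>w\<close> turns any type into a probability space, so constants
  can serve as test variables whatever the sample space type is.\<close>

lemma discrete_rv_on_const:
  assumes "c \<in> S"
  shows "discrete_rv_on S (return (count_space UNIV) w) (\<lambda>_. c)"
proof -
  interpret prob_space "return (count_space UNIV) w"
    by (rule prob_space_return) simp
  have "measure (distr (return (count_space UNIV) w) borel (\<lambda>_. c)) {c} = 1"
    by (subst measure_distr) (auto simp: measure_return)
  then show ?thesis
    using assms prob_space_axioms unfolding discrete_rv_on_def
    by (intro conjI exI[of _ "{c}"]) auto
qed

lemma ext_expectation_integrable:
  assumes "integrable M X"
  shows "ext_expectation M X = ereal (integral\<^sup>L M X)"
proof -
  have "(\<integral>\<^sup>+ w. ennreal (X w) \<partial>M) \<noteq> \<infinity>" "(\<integral>\<^sup>+ w. ennreal (- X w) \<partial>M) \<noteq> \<infinity>"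
    using assms by (auto simp: real_integrable_def)
  then obtain p q where "0 \<le> p" "0 \<le> q"
      "(\<integral>\<^sup>+ w. ennreal (X w) \<partial>M) = ennreal p" "(\<integral>\<^sup>+ w. ennreal (- X w) \<partial>M) = ennreal q"
    by (metis ennreal_cases infinity_ennreal_def)
  then show ?thesis
    by (simp add: ext_expectation_def real_lebesgue_integral_def[OF assms] enn2ereal_ennreal)
qed

lemma ext_expectation_infinite:
  assumes "(\<integral>\<^sup>+ w. ennreal (X w) \<partial>M) = \<infinity>" "(\<integral>\<^sup>+ w. ennreal (- X w) \<partial>M) \<noteq> \<infinity>"
  shows "ext_expectation M X = \<infinity>"
proof -
  obtain q where "0 \<le> q" "(\<integral>\<^sup>+ w. ennreal (- X w) \<partial>M) = ennreal q"
    using assms(2) by (metis ennreal_cases infinity_ennreal_def)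
  with assms(1) show ?thesis
    by (simp add: ext_expectation_def enn2ereal_ennreal)
qed

text \<open>Jensen's inequality for the convex map exp(-\<beta> x). If the expectation is infinite,
  \<open>exp_neg\<close> makes the left side 0; otherwise \<open>X\<close> is integrable and the
  tangent at its mean gives the bound.\<close>

lemma (in prob_space) exp_neg_ext_expectation_le:
  assumes [measurable]: "X \<in> borel_measurable M" and "0 \<le> \<beta>" and bound: "AE w in M. b \<le> X w"
  shows "ennreal (exp_neg \<beta> (ext_expectation M X)) \<le> (\<integral>\<^sup>+ w. ennreal (exp (- \<beta> * X w)) \<partial>M)"
proof -
  \<comment> \<open>The lower bound \<open>b\<close> makes the negative part finite, so
    integrability can fail only through the positive part.\<close>
  have "(\<integral>\<^sup>+ w. ennreal (- X w) \<partial>M) \<le> (\<integral>\<^sup>+ w. ennreal (- b) \<partial>M)"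
    using bound by (intro nn_integral_mono_AE) (auto elim!: eventually_mono intro: ennreal_leI)
  also have "\<dots> < \<infinity>"
    by (simp add: emeasure_space_1)
  finally have neg: "(\<integral>\<^sup>+ w. ennreal (- X w) \<partial>M) \<noteq> \<infinity>"
    by simp
  show ?thesis
  proof (cases "(\<integral>\<^sup>+ w. ennreal (X w) \<partial>M) = \<infinity>")
    case True
    then show ?thesis
      using neg by (simp add: ext_expectation_infinite exp_neg_def)
  next
    case False
    then have int: "integrable M X"
      using neg by (simp add: real_integrable_def)
    define m where "m = expectation X"
    have int_exp: "integrable M (\<lambda>w. exp (- \<beta> * X w))"
    proof (rule integrable_const_bound)
      show "AE w in M. norm (exp (- \<beta> * X w)) \<le> exp (- \<beta> * b)"
        using bound \<open>0 \<le> \<beta>\<close> by (auto elim!: eventually_mono intro: mult_left_mono)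
    qed simp
    \<comment> \<open>The integrand is the tangent of exp(-\<beta> x) at \<open>m\<close>, evaluated
      at \<open>X w\<close>; its linear term has mean zero.\<close>
    have "exp (- \<beta> * m) = (\<integral>w. exp (- \<beta> * m) * (1 - \<beta> * (X w - m)) \<partial>M)"
      using int by (simp add: m_def prob_space)
    also have "\<dots> \<le> (\<integral>w. exp (- \<beta> * X w) \<partial>M)"
    proof (rule integral_mono)
      show "integrable M (\<lambda>w. exp (- \<beta> * m) * (1 - \<beta> * (X w - m)))"
        using int by simp
      fix w
      \<comment> \<open>The tangent lies below the curve, by 1 + u \<le> exp u with u = -\<beta> (X
        w - m).\<close>
      have "exp (- \<beta> * m) * (1 - \<beta> * (X w - m)) \<le> exp (- \<beta> * m) * exp (- \<beta> * (X w - m))"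
        using exp_ge_add_one_self[of "- \<beta> * (X w - m)"] by (intro mult_left_mono) auto
      also have "\<dots> = exp (- \<beta> * X w)"
        by (simp add: exp_add[symmetric] algebra_simps)
      finally show "exp (- \<beta> * m) * (1 - \<beta> * (X w - m)) \<le> exp (- \<beta> * X w)" .
    qed (rule int_exp)
    finally have "ennreal (exp (- \<beta> * m)) \<le> ennreal (\<integral>w. exp (- \<beta> * X w) \<partial>M)"
      by (rule ennreal_leI)
    also have "\<dots> = (\<integral>\<^sup>+ w. ennreal (exp (- \<beta> * X w)) \<partial>M)"
      by (rule nn_integral_eq_integral[OF int_exp, symmetric]) simp
    finally show ?thesis
      using int by (simp add: ext_expectation_integrable exp_neg_def m_def)
  qed
qed

text \<open>The two conditions differ only in the first summand, where Jensen's inequality is scaled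
  by the non-negative factor \<open>(1 - \<omega>) * t\<close>.\<close>

lemma cond_realized_imp_cond_expected:
  assumes "\<omega> \<le> 1" "0 \<le> \<beta>" "0 \<le> t" and rv: "discrete_rv_on {b..} M X"
    and "cond_realized \<omega> \<beta> t T M X"
  shows "cond_expected \<omega> \<beta> t T M X"
proof -
  interpret prob_space M
    using rv by (simp add: discrete_rv_on_def)
  have "ennreal (exp_neg \<beta> (ext_expectation M X)) \<le> (\<integral>\<^sup>+ w. ennreal (exp (- \<beta> * X w)) \<partial>M)"
    using rv discrete_rv_on_AE[OF rv] assms(2)
    by (intro exp_neg_ext_expectation_le) (auto simp: discrete_rv_on_def)
  then have "ennreal ((1 - \<omega>) * t * exp_neg \<beta> (ext_expectation M X))
      \<le> ennreal ((1 - \<omega>) * t) * (\<integral>\<^sup>+ w. ennreal (exp (- \<beta> * X w)) \<partial>M)"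
    using assms(1,3) by (subst ennreal_mult) (auto simp: exp_neg_def intro: mult_left_mono)
  then show ?thesis
    using assms(5) unfolding cond_expected_def cond_realized_def
    by (meson add_right_mono order_trans)
qed

text \<open>\<open>F'\<close> solves (1 - \<omega>) t exp(-\<beta> x) + \<omega> F'(x) = 1 at every
  x, so once \<open>T\<close> is replaced by \<open>F'\<close> the combined integrand is 1 almost
  everywhere.\<close>

lemma cond_realized_of_le_F':
  assumes "0 < \<omega>" "\<omega> \<le> 1" "0 \<le> t" and rv: "discrete_rv_on {b..} M X"
    and T: "\<And>x. b \<le> x \<Longrightarrow> 0 \<le> T x" "\<And>x. b \<le> x \<Longrightarrow> T x \<le> F' \<omega> \<beta> t x"
  shows "cond_realized \<omega> \<beta> t T M X"
proof -
  have [measurable]: "X \<in> borel_measurable M"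
    using rv by (simp add: discrete_rv_on_def)
  interpret prob_space M
    using rv by (simp add: discrete_rv_on_def)
  have bound: "AE w in M. b \<le> X w"
    using discrete_rv_on_AE[OF rv] by simp
  have [measurable]: "(\<lambda>w. F' \<omega> \<beta> t (X w)) \<in> borel_measurable M"
    unfolding F'_def by measurable
  \<comment> \<open>\<open>T\<close> is arbitrary, so it is exchanged for the measurable
    \<open>F'\<close> before the integrals are merged by additivity.\<close>
  have "(\<integral>\<^sup>+ w. ennreal (T (X w)) \<partial>M) \<le> (\<integral>\<^sup>+ w. ennreal (F' \<omega> \<beta> t (X w)) \<partial>M)"
    using bound by (intro nn_integral_mono_AE) (auto elim!: eventually_mono intro: ennreal_leI T)
  then have "ennreal ((1 - \<omega>) * t) * (\<integral>\<^sup>+ w. ennreal (exp (- \<beta> * X w)) \<partial>M)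
        + ennreal \<omega> * (\<integral>\<^sup>+ w. ennreal (T (X w)) \<partial>M)
      \<le> ennreal ((1 - \<omega>) * t) * (\<integral>\<^sup>+ w. ennreal (exp (- \<beta> * X w)) \<partial>M)
        + ennreal \<omega> * (\<integral>\<^sup>+ w. ennreal (F' \<omega> \<beta> t (X w)) \<partial>M)"
    by (intro add_left_mono mult_left_mono) auto
  also have "\<dots> = (\<integral>\<^sup>+ w. ennreal ((1 - \<omega>) * t) * ennreal (exp (- \<beta> * X w))
        + ennreal \<omega> * ennreal (F' \<omega> \<beta> t (X w)) \<partial>M)"
    by (simp add: nn_integral_add nn_integral_cmult)
  also have "\<dots> = (\<integral>\<^sup>+ w. 1 \<partial>M)"
  proof (intro nn_integral_cong_AE eventually_mono[OF bound])
    fix w assume "b \<le> X w"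
    \<comment> \<open>Without this sign, \<open>ennreal\<close> would truncate \<open>F'\<close> to
      0 and the sum would exceed 1.\<close>
    then have "0 \<le> F' \<omega> \<beta> t (X w)"
      using T order_trans by blast
    then show "ennreal ((1 - \<omega>) * t) * ennreal (exp (- \<beta> * X w))
        + ennreal \<omega> * ennreal (F' \<omega> \<beta> t (X w)) = 1"
      using assms(1-3)
      by (simp add: ennreal_mult[symmetric] ennreal_plus[symmetric] F'_def zero_le_divide_iff
          del: ennreal_plus)
  qed
  also have "\<dots> = 1"
    by (simp add: emeasure_space_1)
  finally show ?thesis
    by (simp add: cond_realized_def)
qed

text \<open>A constant \<open>x\<close> is its own expectation, so the condition reads (1 -
  \<omega>) t exp(-\<beta> x) + \<omega> T(x) \<le> 1, which is solved for T(x).\<close>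

lemma cond_expected_const_imp_le_F':
  assumes "0 < \<omega>" "\<omega> \<le> 1" "0 \<le> t" "0 \<le> T x"
    and "cond_expected \<omega> \<beta> t T (return (count_space UNIV) w) (\<lambda>_. x)"
  shows "T x \<le> F' \<omega> \<beta> t x"
proof -
  interpret prob_space "return (count_space UNIV) w"
    by (rule prob_space_return) simp
  have "ext_expectation (return (count_space UNIV) w) (\<lambda>_. x) = ereal x"
    using prob_space by (subst ext_expectation_integrable) auto
  then have "ennreal ((1 - \<omega>) * t * exp (- \<beta> * x) + \<omega> * T x) \<le> ennreal 1"
    using assms
    by (simp add: cond_expected_def exp_neg_def emeasure_space_1[simplified] ennreal_mult)
  then have "(1 - \<omega>) * t * exp (- \<beta> * x) + \<omega> * T x \<le> 1"
    by (subst (asm) ennreal_le_iff) auto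
  then show ?thesis
    using assms(1) by (simp add: F'_def field_simps)
qed

text \<open>Links the sign of \<open>F'\<close> to the admissible range of \<open>t\<close>; the
  case x = b gives the range in the theorem.\<close>

lemma F'_nonneg_iff:
  assumes "0 < \<omega>" "\<omega> < 1"
  shows "0 \<le> F' \<omega> \<beta> t x \<longleftrightarrow> t \<le> exp (\<beta> * x) / (1 - \<omega>)"
proof -
  have "0 \<le> F' \<omega> \<beta> t x \<longleftrightarrow> (1 - \<omega>) * t * exp (- \<beta> * x) \<le> 1"
    using assms by (simp add: F'_def zero_le_divide_iff)
  also have "\<dots> \<longleftrightarrow> t \<le> exp (\<beta> * x) / (1 - \<omega>)"
    using assms by (simp add: exp_minus field_simps)
  finally show ?thesis .
qed

text \<open>The threshold for \<open>t\<close> increases with \<open>x\<close>, so the left endpoint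
  \<open>b\<close> is the most restrictive.\<close>

lemma F'_nonneg:
  assumes "0 < \<omega>" "\<omega> < 1" "0 \<le> \<beta>" "t \<le> exp (\<beta> * b) / (1 - \<omega>)" "b \<le> x"
  shows "0 \<le> F' \<omega> \<beta> t x"
proof -
  have "exp (\<beta> * b) / (1 - \<omega>) \<le> exp (\<beta> * x) / (1 - \<omega>)"
    using assms by (intro divide_right_mono) (auto intro: mult_left_mono)
  then show ?thesis
    using assms F'_nonneg_iff order_trans by blast
qed

(* The sample space type 'a is arbitrary.  Each equivalence holds separately for every 'a, hence
   also when (i) and (ii) range over random variables on probability spaces of all types. *)
theorem mainTheorem2:
  fixes \<omega> \<beta> b t :: real and T' :: "real \<Rightarrow> real"
  assumes "0 < \<omega>" and "\<omega> < 1" and "0 < \<beta>" and "0 \<le> t"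
    and "\<And>x. b \<le> x \<Longrightarrow> 0 \<le> T' x"
  shows
    "((\<forall>(M :: 'a measure) X. discrete_rv_on {b..} M X \<longrightarrow> cond_expected \<omega> \<beta> t T' M X)
        \<longleftrightarrow> (\<forall>(M :: 'a measure) X. discrete_rv_on {b..} M X \<longrightarrow> cond_realized \<omega> \<beta> t T' M X))
     \<and> ((\<forall>(M :: 'a measure) X. discrete_rv_on {b..} M X \<longrightarrow> cond_realized \<omega> \<beta> t T' M X)
        \<longleftrightarrow> (\<forall>x\<ge>b. T' x \<le> F' \<omega> \<beta> t x))
     \<and> ((\<forall>x\<ge>b. T' x \<le> F' \<omega> \<beta> t x) \<longrightarrow> t \<in> {0..exp (\<beta> * b) / (1 - \<omega>)})
     \<and> (\<forall>s\<in>{0..exp (\<beta> * b) / (1 - \<omega>)}.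
          (\<forall>x\<ge>b. 0 \<le> F' \<omega> \<beta> s x)
          \<and> (\<forall>(M :: 'a measure) X. discrete_rv_on {b..} M X
               \<longrightarrow> cond_expected \<omega> \<beta> s (F' \<omega> \<beta> s) M X
                 \<and> cond_realized \<omega> \<beta> s (F' \<omega> \<beta> s) M X))"
proof -
  let ?C = "\<forall>x\<ge>b. T' x \<le> F' \<omega> \<beta> t x"
  let ?E = "\<forall>(M :: 'a measure) X. discrete_rv_on {b..} M X \<longrightarrow> cond_expected \<omega> \<beta> t T' M X"
  let ?R = "\<forall>(M :: 'a measure) X. discrete_rv_on {b..} M X \<longrightarrow> cond_realized \<omega> \<beta> t T' M X"
  \<comment> \<open>Parameter and function are kept general, to cover both \<open>T'\<close> with
    \<open>t\<close> and \<open>F'\<close> with \<open>s\<close>.\<close>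
  have realized: "cond_realized \<omega> \<beta> s T M X"
    if "discrete_rv_on {b..} M X" "0 \<le> s" "\<forall>x\<ge>b. 0 \<le> T x \<and> T x \<le> F' \<omega> \<beta> s x"
    for M :: "'a measure" and X s T
    using that assms(1,2) by (intro cond_realized_of_le_F'[where b = b]) auto
  have expected: "cond_expected \<omega> \<beta> s T M X"
    if "discrete_rv_on {b..} M X" "0 \<le> s" "cond_realized \<omega> \<beta> s T M X"
    for M :: "'a measure" and X s T
    using that assms(2,3) by (intro cond_realized_imp_cond_expected[where b = b]) auto
  have CR: "?C \<Longrightarrow> ?R"
    using realized assms(4,5) by simp
  have RE: "?R \<Longrightarrow> ?E"
    using expected assms(4) by simp
  have EC: ?C if E: ?E
  proof (intro allI impI)
    fix x assume "b \<le> x"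
    \<comment> \<open>\<open>undefined\<close> merely picks some point of the inhabited type to
      carry the mass.\<close>
    then have "cond_expected \<omega> \<beta> t T' (return (count_space UNIV) (undefined :: 'a)) (\<lambda>_. x)"
      by (intro E[rule_format] discrete_rv_on_const) simp
    then show "T' x \<le> F' \<omega> \<beta> t x"
      using assms \<open>b \<le> x\<close> by (intro cond_expected_const_imp_le_F') auto
  qed
  have t: "t \<in> {0..exp (\<beta> * b) / (1 - \<omega>)}" if ?C
  proof -
    \<comment> \<open>Non-negativity of \<open>T'\<close> at the endpoint passes up to
      \<open>F'\<close>.\<close>
    have "0 \<le> F' \<omega> \<beta> t b"
      using that assms(5)[of b] by force
    then show ?thesis
      using assms F'_nonneg_iff by simp
  qed
  have s: "\<forall>x\<ge>b. 0 \<le> F' \<omega> \<beta> s x" if "s \<in> {0..exp (\<beta> * b) / (1 - \<omega>)}" for s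
    using that assms F'_nonneg[of \<omega> \<beta> s b] by simp
  show ?thesis
  proof (intro conjI ballI)
    show "?E \<longleftrightarrow> ?R" "?R \<longleftrightarrow> ?C"
      using CR RE EC by blast+
    show "?C \<longrightarrow> t \<in> {0..exp (\<beta> * b) / (1 - \<omega>)}"
      using t by blast
  next
    fix s assume *: "s \<in> {0..exp (\<beta> * b) / (1 - \<omega>)}"
    show "\<forall>x\<ge>b. 0 \<le> F' \<omega> \<beta> s x"
      by (rule s[OF *])
    show "\<forall>(M :: 'a measure) X. discrete_rv_on {b..} M X
        \<longrightarrow> cond_expected \<omega> \<beta> s (F' \<omega> \<beta> s) M X \<and> cond_realized \<omega> \<beta> s (F' \<omega> \<beta> s) M X"
      \<comment> \<open>Here \<open>F'\<close> is dominated by itself, so its non-negativity is all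
        that remains to supply.\<close>
      using realized[of _ _ s "F' \<omega> \<beta> s"] expected[of _ _ s "F' \<omega> \<beta> s"] s[OF *] * by simp
  qed
qed

end
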